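(* Let $\mathcal C\ne\Omega$ be a cycle. Then for each $\xi_0\in\partial^\star\mathcal C$, $$\lim_{\beta\to\infty}\mathbb P_{\eta_0}[\eta_\beta(\mathcal T_{\partial\mathcal C})=\xi_0]=\frac{\sum_{\eta\in\mathcal C}\mathbf 1\{\eta\sim\xi_0\}}{\sum_{\eta\in\mathcal C}\sum_{\xi\in\partial^\star\mathcal C}\mathbf 1\{\eta\sim\xi\}}\quad\text{for all }\eta_0\in\mathcal C.$$
   Context: $\Omega$ is a finite set with a connected simple undirected graph structure; $\eta\sim\xi$ means that $\{\eta,\xi\}$ is an edge. $\mathbb H:\Omega\to\mathbb R$ is an energy function. For $\beta>0$, $\{\eta_\beta(t)\}_{t\ge0}$ is the continuous-time Markov chain on $\Omega$ with jump rates $r_\beta(\eta,\xi)=e^{-\beta\max\{\mathbb H(\xi)-\mathbb H(\eta),0\}}$ if $\eta\sim\xi$ and $0$ otherwise (Metropolis dynamics); $\mathbb P_\eta$ is its law started from $\eta$, and $\mathcal T_{\mathcal A}$ is the hitting time of a set $\mathcal A$. For $\mathcal A\subseteq\Omega$, the outer boundary is $\partial\mathcal A:=\{\eta\in\Omega\setminus\mathcal A:\eta\sim\xi\text{ for some }\xi\in\mathcal A\}$ and $\partial^\star\mathcal A:=\{\xi\in\partial\mathcal A:\mathbb H(\xi)=\min_{\partial\mathcal A}\mathbb H\}$. A cycle is a nonempty connected set $\mathcal C\subseteq\Omega$ (any two points joined by a path inside $\mathcal C$) with $\max_{\mathcal C}\mathbb H<\min_{\partial\mathcal C}\mathbb H$.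 *)

theory Defs
  imports "HOL-Probability.Probability" "Graph_Theory.Digraph_Component"
begin

section \<open>Continuous-time Markov chains on a finite state space\<close>

text \<open>
  \<open>p t x y\<close> is the probability to go from \<open>x\<close> to \<open>y\<close> in time \<open>t\<close>. The last clause says
  \<open>p h x y = r x y * h + o(h)\<close> as \<open>h\<close> decreases to 0, for \<open>x \<noteq> y\<close>; the diagonal \<open>r x x\<close> plays
  no role. As \<open>S\<close> is meant to be finite, the rates \<open>r\<close> determine \<open>p t x y\<close> for \<open>t \<ge> 0\<close>.
\<close>

definition transition_function ::
    "'a set \<Rightarrow> ('a \<Rightarrow> 'a \<Rightarrow> real) \<Rightarrow> (real \<Rightarrow> 'a \<Rightarrow> 'a \<Rightarrow> real) \<Rightarrow> bool" where
  "transition_function S r p \<longleftrightarrow>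
     (\<forall>t\<ge>0. \<forall>x\<in>S. \<forall>y\<in>S. 0 \<le> p t x y) \<and>
     (\<forall>t\<ge>0. \<forall>x\<in>S. (\<Sum>y\<in>S. p t x y) = 1) \<and>
     (\<forall>x\<in>S. \<forall>y\<in>S. p 0 x y = of_bool (x = y)) \<and>
     (\<forall>s\<ge>0. \<forall>t\<ge>0. \<forall>x\<in>S. \<forall>y\<in>S. p (s + t) x y = (\<Sum>z\<in>S. p s x z * p t z y)) \<and>
     (\<forall>x\<in>S. \<forall>y\<in>S. x \<noteq> y \<longrightarrow>
        ((\<lambda>t. p t x y) has_real_derivative r x y) (at 0 within {0..}))"

text \<open>
  \<open>X\<close>, defined on the probability space \<open>M\<close>, is a Markov chain with jump rates \<open>r\<close> started
  from \<open>x\<^sub>0\<close>: its sample paths are right-continuous with left limits for the discrete topology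
  on \<open>S\<close>, and its finite-dimensional distributions are those given by the transition function
  and the initial state. Only \<open>X t\<close> with \<open>t \<ge> 0\<close> is relevant.
\<close>

definition markov_chain ::
    "'a set \<Rightarrow> ('a \<Rightarrow> 'a \<Rightarrow> real) \<Rightarrow> 'a \<Rightarrow> 'w measure \<Rightarrow> (real \<Rightarrow> 'w \<Rightarrow> 'a) \<Rightarrow> bool" where
  "markov_chain S r x\<^sub>0 M X \<longleftrightarrow>
     prob_space M \<and>
     (\<forall>t\<ge>0. X t \<in> measurable M (count_space S)) \<and>
     (\<forall>\<omega>\<in>space M. \<forall>t\<ge>0. eventually (\<lambda>s. X s \<omega> = X t \<omega>) (at_right t)) \<and>
     (\<forall>\<omega>\<in>space M. \<forall>t>0. \<exists>x\<in>S. eventually (\<lambda>s. X s \<omega> = x) (at_left t)) \<and>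
     (\<exists>p. transition_function S r p \<and>
       (\<forall>(n::nat) (t::nat \<Rightarrow> real) (x::nat \<Rightarrow> 'a).
          t 0 = 0 \<longrightarrow> (\<forall>i<n. t i \<le> t (Suc i)) \<longrightarrow> (\<forall>i\<le>n. x i \<in> S) \<longrightarrow>
          measure M {\<omega>\<in>space M. \<forall>i\<le>n. X (t i) \<omega> = x i} =
            of_bool (x 0 = x\<^sub>0) * (\<Prod>i<n. p (t (Suc i) - t i) (x i) (x (Suc i)))))"

text \<open>The value is \<open>\<infinity>\<close> if \<open>A\<close> is never hit.\<close>

definition hitting_time :: "(real \<Rightarrow> 'w \<Rightarrow> 'a) \<Rightarrow> 'a set \<Rightarrow> 'w \<Rightarrow> ereal" where
  "hitting_time X A \<omega> = Inf {ereal t | t. 0 \<le> t \<and> X t \<omega> \<in> A}"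

text \<open>The event that \<open>A\<close> is hit and that the state at the hitting time is \<open>x\<close>.\<close>

definition hits_at ::
    "'w measure \<Rightarrow> (real \<Rightarrow> 'w \<Rightarrow> 'a) \<Rightarrow> 'a set \<Rightarrow> 'a \<Rightarrow> 'w set" where
  "hits_at M X A x =
     {\<omega>\<in>space M. hitting_time X A \<omega> < \<infinity> \<and> X (real_of_ereal (hitting_time X A \<omega>)) \<omega> = x}"

section \<open>Metropolis dynamics and cycles\<close>

text \<open>
  Finite simple undirected graphs are the \<^locale>\<open>graph\<close>s of the library: finite, symmetric,
  loop-free digraphs without parallel arcs.
\<close>

definition metropolis_rate ::
    "('a, 'b) pre_digraph \<Rightarrow> ('a \<Rightarrow> real) \<Rightarrow> real \<Rightarrow> 'a \<Rightarrow> 'a \<Rightarrow> real" where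
  "metropolis_rate G H \<beta> \<eta> \<xi> =
     (if dominates G \<eta> \<xi> then exp (- \<beta> * max (H \<xi> - H \<eta>) 0) else 0)"

definition outer_boundary :: "('a, 'b) pre_digraph \<Rightarrow> 'a set \<Rightarrow> 'a set" where
  "outer_boundary G A = {\<eta> \<in> verts G - A. \<exists>\<xi>\<in>A. dominates G \<eta> \<xi>}"

definition min_boundary :: "('a, 'b) pre_digraph \<Rightarrow> ('a \<Rightarrow> real) \<Rightarrow> 'a set \<Rightarrow> 'a set" where
  "min_boundary G H A = {\<xi> \<in> outer_boundary G A. H \<xi> = Min (H ` outer_boundary G A)}"

text \<open>
  Nonemptiness of \<open>C\<close> is part of the library's connectedness. The minimum over an empty
  boundary is read as \<open>\<infinity>\<close>.
\<close>

definition energy_cycle :: "('a, 'b) pre_digraph \<Rightarrow> ('a \<Rightarrow> real) \<Rightarrow> 'a set \<Rightarrow> bool" where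
  "energy_cycle G H C \<longleftrightarrow>
     C \<subseteq> verts G \<and> Digraph_Component.connected (G \<restriction> C) \<and>
     (outer_boundary G C = {} \<or> Max (H ` C) < Min (H ` outer_boundary G C))"

end

theory Submission
  imports Defs
begin

text \<open>
  Let \<open>h x\<close> be the probability that the chain started from \<open>x\<close> leaves \<open>C\<close> at \<open>\<xi>\<^sub>0\<close>. It is harmonic on
  \<open>C\<close> for the reversible conductances \<open>exp (- \<beta> * max (H x) (H y))\<close>. With \<open>m\<close> the minimum of
  \<open>H\<close> on the boundary, the Dirichlet energy of \<open>h\<close> inside \<open>C\<close> is of order at most \<open>exp (- \<beta> * m)\<close>,
  whereas the conductances inside \<open>C\<close> are exponentially larger than that. Since \<open>C\<close> is connected,
  \<open>h\<close> is asymptotically constant on \<open>C\<close>. The total flux of \<open>h\<close> through the boundary vanishes,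
  and after division by \<open>exp (- \<beta> * m)\<close> only the edges into the minimal boundary
  survive, which determines the constant.

  The process is given only from one starting point and only through its finite-dimensional
  distributions. So \<open>h\<close> is obtained as a subsequential limit of the hitting probabilities of the
  chains observed at the times \<open>k / (n + 1)\<close>; these agree with the event for the process, path
  by path, once \<open>n\<close> is large.
\<close>

section \<open>Hitting probabilities in discrete time\<close>

text \<open>
  For \<open>z \<in> B\<close>: the probability that the chain with transition matrix \<open>P\<close>, started from \<open>x\<close>,
  enters \<open>B\<close> within \<open>k\<close> steps and does so at \<open>z\<close>.
\<close>

primrec hit_within ::
    "'a set \<Rightarrow> ('a \<Rightarrow> 'a \<Rightarrow> real) \<Rightarrow> 'a set \<Rightarrow> 'a \<Rightarrow> nat \<Rightarrow> 'a \<Rightarrow> real" where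
  "hit_within S P B z 0 = (\<lambda>x. of_bool (x = z))"
| "hit_within S P B z (Suc k) =
     (\<lambda>x. if x \<in> B then of_bool (x = z) else \<Sum>y\<in>S. P x y * hit_within S P B z k y)"

lemma hit_within_bounds:
  assumes "\<And>x y. x \<in> S \<Longrightarrow> y \<in> S \<Longrightarrow> 0 \<le> P x y" and "\<And>x. x \<in> S \<Longrightarrow> (\<Sum>y\<in>S. P x y) = 1"
    and "x \<in> S"
  shows "hit_within S P B z k x \<in> {0..1}"
  using assms(3)
proof (induction k arbitrary: x)
  case (Suc k)
  have "(\<Sum>y\<in>S. P x y * hit_within S P B z k y) \<le> (\<Sum>y\<in>S. P x y)"
    using Suc assms(1) by (intro sum_mono) (auto intro!: mult_left_le)
  then show ?case
    using Suc assms by (auto intro!: sum_nonneg)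
qed auto

text \<open>Induction on \<open>k\<close>, the step being monotonicity of averaging with the
  nonnegative weights \<open>P x y\<close>. The base case rests on \<open>z \<in> B\<close>: a state
  outside \<open>B\<close> differs from \<open>z\<close> and so starts with the value 0.\<close>

lemma hit_within_mono:
  assumes "\<And>x y. x \<in> S \<Longrightarrow> y \<in> S \<Longrightarrow> 0 \<le> P x y" and "\<And>x. x \<in> S \<Longrightarrow> (\<Sum>y\<in>S. P x y) = 1"
    and "x \<in> S" and "z \<in> B"
  shows "hit_within S P B z k x \<le> hit_within S P B z (Suc k) x"
  using assms(3)
proof (induction k arbitrary: x)
  case 0
  then show ?case
    using assms by (auto intro!: sum_nonneg)
next
  case (Suc k)
  have "(\<Sum>y\<in>S. P x y * hit_within S P B z k y)
      \<le> (\<Sum>y\<in>S. P x y * hit_within S P B z (Suc k) y)"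
    using Suc assms(1) by (intro sum_mono mult_left_mono) auto
  then show ?case
    by simp
qed

text \<open>The Markov property at time \<open>m\<close>, in the form that finite-dimensional
  distributions give directly: the past is a fixed prefix of states instead of a sigma-algebra. The
  induction on \<open>k\<close> keeps \<open>m\<close> and \<open>x\<close> arbitrary because its
  step lengthens the prefix by one state.\<close>

lemma hit_within_prefix:
  assumes "prob_space M" and "finite S"
    and Y: "\<And>k. Y k \<in> measurable M (count_space S)"
    and "z \<in> B"
    and fdd: "\<And>n x. (\<And>i. i \<le> n \<Longrightarrow> x i \<in> S) \<Longrightarrow>
      measure M {\<omega>\<in>space M. \<forall>i\<le>n. Y i \<omega> = x i} =
        of_bool (x 0 = x\<^sub>0) * (\<Prod>i<n. P (x i) (x (Suc i)))"
    and "\<And>i. i \<le> m \<Longrightarrow> x i \<in> S"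
  shows "measure M {\<omega>\<in>space M. (\<forall>i\<le>m. Y i \<omega> = x i) \<and>
           (\<exists>j\<le>k. Y (m + j) \<omega> = z \<and> (\<forall>i<j. Y (m + i) \<omega> \<notin> B))} =
         measure M {\<omega>\<in>space M. \<forall>i\<le>m. Y i \<omega> = x i} * hit_within S P B z k (x m)"
proof -
  interpret prob_space M by fact
  show ?thesis
    using assms(6)
  proof (induction k arbitrary: m x)
    case 0
    have "{\<omega>\<in>space M. (\<forall>i\<le>m. Y i \<omega> = x i) \<and> Y m \<omega> = z} =
        (if x m = z then {\<omega>\<in>space M. \<forall>i\<le>m. Y i \<omega> = x i} else {})"
      by auto
    then show ?case
      by simp
  next
    case (Suc k)
    let ?E = "\<lambda>m k x. {\<omega>\<in>space M. (\<forall>i\<le>m. Y i \<omega> = x i) \<and>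
             (\<exists>j\<le>k. Y (m + j) \<omega> = z \<and> (\<forall>i<j. Y (m + i) \<omega> \<notin> B))}"
    let ?D = "\<lambda>m x. {\<omega>\<in>space M. \<forall>i\<le>m. Y i \<omega> = x i}"
    show ?case
    proof (cases "x m \<in> B")
      case True
      have "?E m (Suc k) x = (if x m = z then ?D m x else {})"
      proof -
        have "(\<exists>j\<le>Suc k. Y (m + j) \<omega> = z \<and> (\<forall>i<j. Y (m + i) \<omega> \<notin> B)) \<longleftrightarrow> x m = z"
          if eq: "\<forall>i\<le>m. Y i \<omega> = x i" for \<omega>
        proof
          assume "\<exists>j\<le>Suc k. Y (m + j) \<omega> = z \<and> (\<forall>i<j. Y (m + i) \<omega> \<notin> B)"
          then obtain j where j: "Y (m + j) \<omega> = z" "\<forall>i<j. Y (m + i) \<omega> \<notin> B"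
            by blast
          have "Y (m + 0) \<omega> \<in> B"
            using eq True by simp
          then have "j = 0"
            using j(2) by blast
          then show "x m = z"
            using j(1) eq by simp
        next
          assume "x m = z"
          then show "\<exists>j\<le>Suc k. Y (m + j) \<omega> = z \<and> (\<forall>i<j. Y (m + i) \<omega> \<notin> B)"
            using eq by (intro exI[of _ 0]) simp
        qed
        then show ?thesis
          by auto
      qed
      then show ?thesis
        using True by simp
    next
      case False
      let ?x = "\<lambda>y. x(Suc m := y)"
      \<comment> \<open>The state \<open>x m\<close> lies outside \<open>B\<close> and
        \<open>z\<close> lies in \<open>B\<close>, so the hit cannot occur at time \<open>m\<close>.
        The search may start at \<open>Suc m\<close> with one step fewer.\<close>
      have shift: "(\<exists>j\<le>Suc k. Y (m + j) \<omega> = z \<and> (\<forall>i<j. Y (m + i) \<omega> \<notin> B)) \<longleftrightarrow>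
          (\<exists>j\<le>k. Y (Suc m + j) \<omega> = z \<and> (\<forall>i<j. Y (Suc m + i) \<omega> \<notin> B))"
        if "Y m \<omega> = x m" for \<omega>
      proof
        assume "\<exists>j\<le>Suc k. Y (m + j) \<omega> = z \<and> (\<forall>i<j. Y (m + i) \<omega> \<notin> B)"
        then obtain j where j: "j \<le> Suc k" "Y (m + j) \<omega> = z" "\<forall>i<j. Y (m + i) \<omega> \<notin> B"
          by blast
        moreover have "j \<noteq> 0"
          using j that False \<open>z \<in> B\<close> by (intro notI) auto
        ultimately obtain l where "j = Suc l"
          using not0_implies_Suc by blast
        with j show "\<exists>j\<le>k. Y (Suc m + j) \<omega> = z \<and> (\<forall>i<j. Y (Suc m + i) \<omega> \<notin> B)"
          by (intro exI[of _ l]) auto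
      next
        assume "\<exists>j\<le>k. Y (Suc m + j) \<omega> = z \<and> (\<forall>i<j. Y (Suc m + i) \<omega> \<notin> B)"
        then obtain j where j: "j \<le> k" "Y (Suc m + j) \<omega> = z" "\<forall>i<j. Y (Suc m + i) \<omega> \<notin> B"
          by blast
        have "Y (m + i) \<omega> \<notin> B" if "i < Suc j" for i
          using that j(3) \<open>Y m \<omega> = x m\<close> False by (cases i) auto
        with j show "\<exists>j\<le>Suc k. Y (m + j) \<omega> = z \<and> (\<forall>i<j. Y (m + i) \<omega> \<notin> B)"
          by (intro exI[of _ "Suc j"]) auto
      qed
      have inS: "Y (Suc m) \<omega> \<in> S" if "\<omega> \<in> space M" for \<omega>
        using measurable_space[OF Y that, of "Suc m"] by simp
      have prefix: "(\<forall>i\<le>Suc m. Y i \<omega> = ?x y i) \<longleftrightarrow> (\<forall>i\<le>m. Y i \<omega> = x i) \<and> Y (Suc m) \<omega> = y" for \<omega> y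
        by (auto simp: le_Suc_eq)
      have split: "?E m (Suc k) x = (\<Union>y\<in>S. ?E (Suc m) k (?x y))"
      proof -
        have "?E m (Suc k) x = {\<omega>\<in>space M. (\<forall>i\<le>m. Y i \<omega> = x i) \<and>
            (\<exists>j\<le>k. Y (Suc m + j) \<omega> = z \<and> (\<forall>i<j. Y (Suc m + i) \<omega> \<notin> B))}"
          by (intro Collect_cong conj_cong refl) (rule shift, simp)
        moreover have "{\<omega>\<in>space M. Q \<omega> \<and> R \<omega>} =
            (\<Union>y\<in>S. {\<omega>\<in>space M. (Q \<omega> \<and> Y (Suc m) \<omega> = y) \<and> R \<omega>})" for Q R
          using inS by auto
        ultimately show ?thesis
          unfolding prefix by (rule trans)
      qed
      have [measurable]: "Measurable.pred M (\<lambda>\<omega>. Y i \<omega> = y)" "Measurable.pred M (\<lambda>\<omega>. Y i \<omega> \<in> B)" for i y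
        by (rule measurable_compose[OF Y], simp)+
      have "measure M (?E m (Suc k) x) = (\<Sum>y\<in>S. measure M (?E (Suc m) k (?x y)))"
        unfolding split
      proof (rule measure_finite_Union[OF \<open>finite S\<close>])
        show "(\<lambda>y. ?E (Suc m) k (?x y)) ` S \<subseteq> sets M"
          by auto
        show "disjoint_family_on (\<lambda>y. ?E (Suc m) k (?x y)) S"
          unfolding prefix disjoint_family_on_def by auto
        show "emeasure M (?E (Suc m) k (?x y)) \<noteq> \<infinity>" if "y \<in> S" for y
          by simp
      qed
      also have "\<dots> = (\<Sum>y\<in>S. measure M (?D m x) * (P (x m) y * hit_within S P B z k y))"
      proof (rule sum.cong[OF refl])
        fix y assume "y \<in> S"
        have inS': "?x y i \<in> S" if "i \<le> Suc m" for i
          using that Suc.prems \<open>y \<in> S\<close> by (auto simp: le_Suc_eq)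
        \<comment> \<open>The update at \<open>Suc m\<close> leaves the first \<open>m\<close>
          factors alone, so lengthening the prefix by \<open>y\<close> costs exactly the factor
          \<open>P (x m) y\<close>.\<close>
        have "(\<Prod>i<m. P (?x y i) (?x y (Suc i))) = (\<Prod>i<m. P (x i) (x (Suc i)))"
          by (intro prod.cong) auto
        then have "measure M (?D (Suc m) (?x y)) = measure M (?D m x) * P (x m) y"
          using fdd[of "Suc m" "?x y"] fdd[of m x] inS' Suc.prems by simp
        then show "measure M (?E (Suc m) k (?x y)) =
            measure M (?D m x) * (P (x m) y * hit_within S P B z k y)"
          using Suc.IH[of "Suc m" "?x y"] inS' by simp
      qed
      finally show ?thesis
        using False by (simp add: sum_distrib_left)
    qed
  qed
qed

text \<open>The function is the increasing limit of \<open>hit_within\<close> in the number of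
  steps, and its harmonicity is the limit of the recursion. Only the value at
  \<open>x\<^sub>0\<close> is tied to the process; the other values come from the matrix
  \<open>P\<close> alone.\<close>

lemma discrete_hitting_probability_harmonic:
  assumes "prob_space M" and "finite S"
    and Y: "\<And>k. Y k \<in> measurable M (count_space S)"
    and "z \<in> B" and "x\<^sub>0 \<in> S"
    and P0: "\<And>x y. x \<in> S \<Longrightarrow> y \<in> S \<Longrightarrow> 0 \<le> P x y" and P1: "\<And>x. x \<in> S \<Longrightarrow> (\<Sum>y\<in>S. P x y) = 1"
    and fdd: "\<And>n x. (\<And>i. i \<le> n \<Longrightarrow> x i \<in> S) \<Longrightarrow>
      measure M {\<omega>\<in>space M. \<forall>i\<le>n. Y i \<omega> = x i} =
        of_bool (x 0 = x\<^sub>0) * (\<Prod>i<n. P (x i) (x (Suc i)))"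
  obtains h where "\<And>x. x \<in> S \<Longrightarrow> h x \<in> {0..1}" and "\<And>x. x \<in> B \<Longrightarrow> h x = of_bool (x = z)"
    and "\<And>x. x \<in> S - B \<Longrightarrow> h x = (\<Sum>y\<in>S. P x y * h y)"
    and "measure M {\<omega>\<in>space M. \<exists>k. Y k \<omega> = z \<and> (\<forall>j<k. Y j \<omega> \<notin> B)} = h x\<^sub>0"
proof -
  interpret prob_space M by fact
  have [measurable]: "Measurable.pred M (\<lambda>\<omega>. Y i \<omega> = y)" "Measurable.pred M (\<lambda>\<omega>. Y i \<omega> \<in> B)" for i y
    by (rule measurable_compose[OF Y], simp)+
  let ?q = "hit_within S P B z"
  have q: "?q k x \<in> {0..1}" if "x \<in> S" for k x
    using hit_within_bounds[OF P0 P1 that] by simp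
  have "incseq (\<lambda>k. ?q k x)" if "x \<in> S" for x
    using hit_within_mono[of S P x z B] P0 P1 that \<open>z \<in> B\<close> by (intro incseq_SucI) blast
  then have "convergent (\<lambda>k. ?q k x)" if "x \<in> S" for x
    using that q[OF that]
    by (intro Bseq_mono_convergent BseqI'[of _ 1]) (auto simp: incseq_def)
  then have lim: "(\<lambda>k. ?q k x) \<longlonglongrightarrow> lim (\<lambda>k. ?q k x)" if "x \<in> S" for x
    using that by (simp add: convergent_LIMSEQ_iff)
  define h where "h x = lim (\<lambda>k. ?q k x)" for x
  show ?thesis
  proof
    show "h x \<in> {0..1}" if "x \<in> S" for x
      using lim[OF that] q[OF that] unfolding h_def
      by (auto intro: LIMSEQ_le_const LIMSEQ_le_const2)
    show "h x = of_bool (x = z)" if "x \<in> B" for x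
    proof -
      have "?q k x = of_bool (x = z)" for k
        using that by (cases k) auto
      then show ?thesis
        by (simp add: h_def)
    qed
    show "h x = (\<Sum>y\<in>S. P x y * h y)" if "x \<in> S - B" for x
    proof (rule LIMSEQ_unique)
      show "(\<lambda>k. ?q (Suc k) x) \<longlonglongrightarrow> h x"
        unfolding h_def using lim[of x] that by (intro LIMSEQ_Suc) auto
      show "(\<lambda>k. ?q (Suc k) x) \<longlonglongrightarrow> (\<Sum>y\<in>S. P x y * h y)"
        using that lim by (auto simp: h_def intro!: tendsto_intros)
    qed
    let ?E = "\<lambda>k. {\<omega>\<in>space M. \<exists>j\<le>k. Y j \<omega> = z \<and> (\<forall>i<j. Y i \<omega> \<notin> B)}"
    \<comment> \<open>The start is almost surely \<open>x\<^sub>0\<close>, so this condition can be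
      added to the event. The prefix formula then applies with \<open>m = 0\<close>.\<close>
    have "prob {\<omega>\<in>space M. Y 0 \<omega> = x\<^sub>0} = 1"
      using fdd[of 0 "\<lambda>_. x\<^sub>0"] \<open>x\<^sub>0 \<in> S\<close> by simp
    then have start: "AE \<omega> in M. Y 0 \<omega> = x\<^sub>0"
      by (simp add: prob_Collect_eq_1)
    have "prob (?E k) = ?q k x\<^sub>0" for k
    proof -
      have "prob (?E k) = prob {\<omega>\<in>space M. Y 0 \<omega> = x\<^sub>0 \<and> (\<exists>j\<le>k. Y j \<omega> = z \<and> (\<forall>i<j. Y i \<omega> \<notin> B))}"
        using start by (intro finite_measure_eq_AE) auto
      also have "\<dots> = prob {\<omega>\<in>space M. Y 0 \<omega> = x\<^sub>0} * ?q k x\<^sub>0"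
        using hit_within_prefix[OF \<open>prob_space M\<close> \<open>finite S\<close> Y \<open>z \<in> B\<close> fdd,
            of 0 "\<lambda>_. x\<^sub>0" k] \<open>x\<^sub>0 \<in> S\<close> by simp
      finally show ?thesis
        using \<open>prob {\<omega>\<in>space M. Y 0 \<omega> = x\<^sub>0} = 1\<close> by simp
    qed
    moreover have "(\<lambda>k. prob (?E k)) \<longlonglongrightarrow> prob (\<Union>k. ?E k)"
      by (intro finite_Lim_measure_incseq incseq_SucI) (auto, blast intro: le_SucI)
    moreover have "(\<Union>k. ?E k) = {\<omega>\<in>space M. \<exists>k. Y k \<omega> = z \<and> (\<forall>j<k. Y j \<omega> \<notin> B)}"
      by auto
    ultimately have "(\<lambda>k. ?q k x\<^sub>0) \<longlonglongrightarrow> prob {\<omega>\<in>space M. \<exists>k. Y k \<omega> = z \<and> (\<forall>j<k. Y j \<omega> \<notin> B)}"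
      by simp
    then show "prob {\<omega>\<in>space M. \<exists>k. Y k \<omega> = z \<and> (\<forall>j<k. Y j \<omega> \<notin> B)} = h x\<^sub>0"
      unfolding h_def by (rule LIMSEQ_unique) (rule lim[OF \<open>x\<^sub>0 \<in> S\<close>])
  qed
qed

section \<open>Discretization of the hitting event\<close>

text \<open>The infimum is attained. If the path were outside \<open>A\<close> at time
  \<open>T\<close>, right continuity would keep it outside on an interval to the right of
  \<open>T\<close>, and the infimum would be larger than \<open>T\<close>.\<close>

lemma hitting_time_finite_cases:
  assumes right: "\<And>t. 0 \<le> t \<Longrightarrow> eventually (\<lambda>s. X s \<omega> = X t \<omega>) (at_right t)"
    and "hitting_time X A \<omega> < \<infinity>"
  obtains T where "hitting_time X A \<omega> = ereal T" and "0 \<le> T" and "X T \<omega> \<in> A"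
    and "\<And>s. 0 \<le> s \<Longrightarrow> s < T \<Longrightarrow> X s \<omega> \<notin> A"
proof -
  let ?U = "{ereal t | t. 0 \<le> t \<and> X t \<omega> \<in> A}"
  have I: "hitting_time X A \<omega> = Inf ?U"
    by (simp add: hitting_time_def)
  have ge0: "0 \<le> hitting_time X A \<omega>"
    unfolding I by (intro Inf_greatest) auto
  then obtain T where T: "hitting_time X A \<omega> = ereal T" and "0 \<le> T"
    using assms(2) by (cases "hitting_time X A \<omega>") auto
  have below: "X s \<omega> \<notin> A" if "0 \<le> s" "s < T" for s
  proof
    assume "X s \<omega> \<in> A"
    then have "Inf ?U \<le> ereal s"
      using that by (intro Inf_lower) auto
    then show False
      using that T I by simp
  qed
  have "X T \<omega> \<in> A"
  proof (rule ccontr)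
    assume notin: "X T \<omega> \<notin> A"
    obtain b where "b > T" and b: "\<And>s. T < s \<Longrightarrow> s < b \<Longrightarrow> X s \<omega> = X T \<omega>"
      using right[OF \<open>0 \<le> T\<close>] unfolding eventually_at_right_field by blast
    have "ereal b \<le> Inf ?U"
    proof (rule Inf_greatest)
      fix u assume "u \<in> ?U"
      then obtain t where t: "u = ereal t" "0 \<le> t" "X t \<omega> \<in> A"
        by blast
      then have "\<not> t < b"
        using below[of t] b[of t] notin by (cases t T rule: linorder_cases) auto
      then show "ereal b \<le> u"
        using t by simp
    qed
    then show False
      using T I \<open>b > T\<close> by simp
  qed
  then show ?thesis
    using that T \<open>0 \<le> T\<close> below by blast
qed

text \<open>
  By right continuity the path stays at its hitting state for a positive time, which contains
  a grid point as soon as the mesh is small.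
\<close>

lemma eventually_grid_hit_iff:
  assumes right: "\<And>t. 0 \<le> t \<Longrightarrow> eventually (\<lambda>s. X s \<omega> = X t \<omega>) (at_right t)"
    and "\<omega> \<in> space M" and "z \<in> A"
  shows "eventually (\<lambda>n. (\<exists>k. X (real k / real (Suc n)) \<omega> = z \<and>
             (\<forall>j<k. X (real j / real (Suc n)) \<omega> \<notin> A)) \<longleftrightarrow> \<omega> \<in> hits_at M X A z) sequentially"
proof (cases "hitting_time X A \<omega> < \<infinity>")
  case False
  \<comment> \<open>A path that never meets \<open>A\<close> belongs to neither event, since
    \<open>z\<close> lies in \<open>A\<close>.\<close>
  have "X t \<omega> \<notin> A" if "0 \<le> t" for t
  proof
    assume "X t \<omega> \<in> A"
    then have "hitting_time X A \<omega> \<le> ereal t"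
      unfolding hitting_time_def using that by (intro Inf_lower) auto
    then show False
      using False by auto
  qed
  then have "X (real k / real (Suc n)) \<omega> \<noteq> z" for k n
    using \<open>z \<in> A\<close> by (metis divide_nonneg_nonneg of_nat_0_le_iff)
  then show ?thesis
    using False by (simp add: hits_at_def)
next
  case True
  then obtain T where T: "hitting_time X A \<omega> = ereal T" "0 \<le> T" "X T \<omega> \<in> A"
    and below: "\<And>s. 0 \<le> s \<Longrightarrow> s < T \<Longrightarrow> X s \<omega> \<notin> A"
    using hitting_time_finite_cases[of X \<omega> A, OF right] by blast
  obtain b where "b > T" and b: "\<And>s. T < s \<Longrightarrow> s < b \<Longrightarrow> X s \<omega> = X T \<omega>"
    using right[OF \<open>0 \<le> T\<close>] unfolding eventually_at_right_field by blast
  have "(\<lambda>n. 1 / real (Suc n)) \<longlonglongrightarrow> 0"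
    by (rule LIMSEQ_Suc[OF lim_1_over_n])
  then have "eventually (\<lambda>n. 1 / real (Suc n) < b - T) sequentially"
    using \<open>b > T\<close> by (intro order_tendstoD) auto
  then show ?thesis
  proof eventually_elim
    case (elim n)
    let ?t = "\<lambda>k. real k / real (Suc n)"
    \<comment> \<open>The index of the first grid point that is not before \<open>T\<close>. Once
      the mesh is below \<open>b - T\<close>, this point lies in the interval from \<open>T\<close>
      to \<open>b\<close>, where the path has its hitting state.\<close>
    define K where "K = nat \<lceil>T * real (Suc n)\<rceil>"
    have K: "real K = of_int \<lceil>T * real (Suc n)\<rceil>"
      unfolding K_def using \<open>0 \<le> T\<close> by (simp add: order_trans[of _ 0])
    have "T * real (Suc n) \<le> real K" "real K < T * real (Suc n) + 1"
      unfolding K by linarith+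
    then have "T \<le> ?t K" "?t K < T + 1 / real (Suc n)"
      by (simp_all add: pos_le_divide_eq pos_divide_less_eq distrib_right del: of_nat_Suc)
    then have XK: "X (?t K) \<omega> = X T \<omega>"
      using b[of "?t K"] elim by (cases "?t K = T") auto
    have before: "X (?t j) \<omega> \<notin> A" if "j < K" for j
    proof (rule below)
      have "real j < T * real (Suc n)"
        using that unfolding K_def by linarith
      then show "?t j < T"
        by (simp add: pos_divide_less_eq del: of_nat_Suc)
    qed simp
    have "(\<exists>k. X (?t k) \<omega> = z \<and> (\<forall>j<k. X (?t j) \<omega> \<notin> A)) \<longleftrightarrow> X T \<omega> = z"
    proof
      assume "\<exists>k. X (?t k) \<omega> = z \<and> (\<forall>j<k. X (?t j) \<omega> \<notin> A)"
      then obtain k where k: "X (?t k) \<omega> = z" "\<And>j. j < k \<Longrightarrow> X (?t j) \<omega> \<notin> A"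
        by blast
      \<comment> \<open>Both indices mark the first grid visit to \<open>A\<close>, so neither can
        precede the other.\<close>
      then have "k = K"
        using before[of k] k(2)[of K] XK T(3) \<open>z \<in> A\<close> by (metis linorder_neqE_nat)
      then show "X T \<omega> = z"
        using k XK by simp
    next
      assume "X T \<omega> = z"
      then show "\<exists>k. X (?t k) \<omega> = z \<and> (\<forall>j<k. X (?t j) \<omega> \<notin> A)"
        using XK before by blast
    qed
    then show ?case
      using T \<open>\<omega> \<in> space M\<close> by (simp add: hits_at_def)
  qed
qed

section \<open>Passage to the limit of vanishing mesh\<close>

lemma (in prob_space) tendsto_measure_of_eventually_iff:
  assumes [measurable]: "\<And>n. E n \<in> events" and "L \<subseteq> space M"
    and ev: "\<And>\<omega>. \<omega> \<in> space M \<Longrightarrow> eventually (\<lambda>n::nat. \<omega> \<in> E n \<longleftrightarrow> \<omega> \<in> L) sequentially"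
  shows "(\<lambda>n. prob (E n)) \<longlonglongrightarrow> prob L"
proof -
  have "eventually (\<lambda>n. \<omega> \<in> E n) sequentially \<longleftrightarrow> \<omega> \<in> L" if "\<omega> \<in> space M" for \<omega>
  proof -
    have "eventually (\<lambda>n. \<omega> \<in> E n) sequentially \<longleftrightarrow> eventually (\<lambda>n::nat. \<omega> \<in> L) sequentially"
      by (rule eventually_cong[OF ev[OF that]])
    then show ?thesis
      by simp
  qed
  \<comment> \<open>Measurability of \<open>L\<close> is derived: eventual agreement makes it the
    lower limit of the events \<open>E n\<close>. For the hitting event, defined by an infimum over
    uncountably many times, this replaces a separate argument.\<close>
  then have L: "L = {\<omega>\<in>space M. \<exists>N. \<forall>n\<ge>N. \<omega> \<in> E n}"
    using \<open>L \<subseteq> space M\<close> unfolding eventually_sequentially by blast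
  have [measurable]: "L \<in> events"
    unfolding L by measurable
  have "(\<lambda>n. integral\<^sup>L M (indicator (E n) :: _ \<Rightarrow> real)) \<longlonglongrightarrow> integral\<^sup>L M (indicator L)"
  proof (rule integral_dominated_convergence[where w="\<lambda>_. 1"])
    show "AE \<omega> in M. (\<lambda>n. indicator (E n) \<omega> :: real) \<longlonglongrightarrow> indicator L \<omega>"
    proof (intro AE_I2 tendsto_eventually)
      fix \<omega> assume "\<omega> \<in> space M"
      show "eventually (\<lambda>n. indicator (E n) \<omega> = (indicator L \<omega> :: real)) sequentially"
        using ev[OF \<open>\<omega> \<in> space M\<close>] by eventually_elim (simp add: indicator_def)
    qed
  qed (auto simp: indicator_def)
  then show ?thesis
    by simp
qed

text \<open>Compactness of the interval is applied to one point after another, each time along a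
  further subsequence of the previous one.\<close>

lemma convergent_subsequence_on_finite:
  fixes f :: "nat \<Rightarrow> 'a \<Rightarrow> real"
  assumes "finite S" and "\<And>n x. x \<in> S \<Longrightarrow> f n x \<in> {a..b}"
  shows "\<exists>h r. strict_mono (r :: nat \<Rightarrow> nat) \<and> (\<forall>x\<in>S. (\<lambda>n. f (r n) x) \<longlonglongrightarrow> h x)"
  using assms
proof (induction S rule: finite_induct)
  case empty
  show ?case
    using strict_mono_id by fastforce
next
  case (insert s S)
  then obtain h and r :: "nat \<Rightarrow> nat"
    where r: "strict_mono r" and h: "\<And>x. x \<in> S \<Longrightarrow> (\<lambda>n. f (r n) x) \<longlonglongrightarrow> h x"
    by (metis insertCI)
  have "\<forall>n. (\<lambda>n. f (r n) s) n \<in> {a..b}"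
    using insert.prems by blast
  then obtain l and q :: "nat \<Rightarrow> nat"
    where q: "strict_mono q" and l: "((\<lambda>n. f (r n) s) \<circ> q) \<longlonglongrightarrow> l"
    using compact_Icc[of a b, unfolded compact_def, rule_format, of "\<lambda>n. f (r n) s"] by blast
  have "(\<lambda>n. f ((r \<circ> q) n) x) \<longlonglongrightarrow> (h(s := l)) x" if "x \<in> insert s S" for x
  proof (cases "x = s")
    case True
    then show ?thesis
      using l by (simp add: o_def)
  next
    case False
    then show ?thesis
      using that LIMSEQ_subseq_LIMSEQ[OF h q, of x] by (simp add: o_def)
  qed
  then show ?case
    using strict_mono_o[OF r q] by blast
qed

text \<open>The discrete harmonic functions for mesh \<open>d n\<close> have a subsequential limit
  \<open>g\<close>. Dividing their equations by \<open>d n\<close> turns transition probabilities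
  into jump rates. At \<open>x\<^sub>0\<close> the whole sequence converges to the probability of
  the hitting event, so the choice of subsequence does not affect that value.\<close>

lemma markov_chain_hitting_harmonic:
  assumes chain: "markov_chain S r x\<^sub>0 M X" and "finite S" and "B \<subseteq> S" and "z \<in> B" and "x\<^sub>0 \<in> S"
  obtains h where "\<And>x. x \<in> S \<Longrightarrow> h x \<in> {0..1}" and "\<And>x. x \<in> B \<Longrightarrow> h x = of_bool (x = z)"
    and "\<And>x. x \<in> S - B \<Longrightarrow> (\<Sum>y\<in>S. r x y * (h y - h x)) = 0"
    and "measure M (hits_at M X B z) = h x\<^sub>0"
proof -
  have "prob_space M" and X: "\<And>t. 0 \<le> t \<Longrightarrow> X t \<in> measurable M (count_space S)"
    and right: "\<And>\<omega> t. \<omega> \<in> space M \<Longrightarrow> 0 \<le> t \<Longrightarrow> eventually (\<lambda>s. X s \<omega> = X t \<omega>) (at_right t)"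
    using chain by (auto simp: markov_chain_def)
  obtain p where p: "transition_function S r p"
    and fdd: "\<forall>(n::nat) (t::nat \<Rightarrow> real) (x::nat \<Rightarrow> 'a).
          t 0 = 0 \<longrightarrow> (\<forall>i<n. t i \<le> t (Suc i)) \<longrightarrow> (\<forall>i\<le>n. x i \<in> S) \<longrightarrow>
          measure M {\<omega>\<in>space M. \<forall>i\<le>n. X (t i) \<omega> = x i} =
            of_bool (x 0 = x\<^sub>0) * (\<Prod>i<n. p (t (Suc i) - t i) (x i) (x (Suc i)))"
    using chain unfolding markov_chain_def by (elim conjE exE) (rule that)
  have p0: "\<And>t x y. 0 \<le> t \<Longrightarrow> x \<in> S \<Longrightarrow> y \<in> S \<Longrightarrow> 0 \<le> p t x y"
    and p1: "\<And>t x. 0 \<le> t \<Longrightarrow> x \<in> S \<Longrightarrow> (\<Sum>y\<in>S. p t x y) = 1"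
    and p_init: "\<And>x y. x \<in> S \<Longrightarrow> y \<in> S \<Longrightarrow> p 0 x y = of_bool (x = y)"
    and p_deriv: "\<And>x y. x \<in> S \<Longrightarrow> y \<in> S \<Longrightarrow> x \<noteq> y \<Longrightarrow>
        ((\<lambda>t. p t x y) has_real_derivative r x y) (at 0 within {0..})"
    using p by (auto simp: transition_function_def)
  interpret prob_space M by fact
  define d where "d n = 1 / real (Suc n)" for n
  have d0: "0 < d n" for n
    by (simp add: d_def)
  have d_lim: "d \<longlonglongrightarrow> 0"
    unfolding d_def by (rule LIMSEQ_Suc[OF lim_1_over_n])
  define Y where "Y n k = X (real k / real (Suc n))" for n k
  define E where "E n = {\<omega>\<in>space M. \<exists>k. Y n k \<omega> = z \<and> (\<forall>j<k. Y n j \<omega> \<notin> B)}" for n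
  have Y: "Y n k \<in> measurable M (count_space S)" for n k
    unfolding Y_def by (rule X) simp
  have [measurable]: "Measurable.pred M (\<lambda>\<omega>. Y n i \<omega> = y)" "Measurable.pred M (\<lambda>\<omega>. Y n i \<omega> \<in> B)" for n i y
    by (rule measurable_compose[OF Y], simp)+
  define Q where "Q n h \<longleftrightarrow> (\<forall>x\<in>S. h x \<in> {0..1}) \<and> (\<forall>x\<in>B. h x = of_bool (x = z)) \<and>
      (\<forall>x\<in>S - B. h x = (\<Sum>y\<in>S. p (d n) x y * h y)) \<and> prob (E n) = h x\<^sub>0" for n h
  have "\<exists>h. Q n h" for n
  proof -
    have le: "0 \<le> d n"
      using d0[of n] by simp
    have grid_fdd: "prob {\<omega>\<in>space M. \<forall>i\<le>m. Y n i \<omega> = x i} =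
        of_bool (x 0 = x\<^sub>0) * (\<Prod>i<m. p (d n) (x i) (x (Suc i)))"
      if "\<And>i. i \<le> m \<Longrightarrow> x i \<in> S" for m x
    proof -
      have "real (Suc i) / real (Suc n) - real i / real (Suc n) = d n" for i
        by (simp add: d_def diff_divide_distrib[symmetric])
      then show ?thesis
        using fdd[rule_format, of "\<lambda>i. real i / real (Suc n)" m x] that
        by (simp add: Y_def divide_right_mono)
    qed
    obtain h where "\<And>x. x \<in> S \<Longrightarrow> h x \<in> {0..1}" "\<And>x. x \<in> B \<Longrightarrow> h x = of_bool (x = z)"
      "\<And>x. x \<in> S - B \<Longrightarrow> h x = (\<Sum>y\<in>S. p (d n) x y * h y)" "prob (E n) = h x\<^sub>0"
      unfolding E_def
      by (rule discrete_hitting_probability_harmonic[OF \<open>prob_space M\<close> \<open>finite S\<close> Y[of n]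
          \<open>z \<in> B\<close> \<open>x\<^sub>0 \<in> S\<close> p0[OF le] p1[OF le] grid_fdd]) blast+
    then show ?thesis
      unfolding Q_def by (intro exI[of _ h] conjI ballI)
  qed
  then obtain h where "\<And>n. Q n (h n)"
    by metis
  then have h01: "\<And>n x. x \<in> S \<Longrightarrow> h n x \<in> {0..1}"
    and hB: "\<And>n x. x \<in> B \<Longrightarrow> h n x = of_bool (x = z)"
    and hharm: "\<And>n x. x \<in> S - B \<Longrightarrow> h n x = (\<Sum>y\<in>S. p (d n) x y * h n y)"
    and hE: "\<And>n. prob (E n) = h n x\<^sub>0"
    unfolding Q_def by blast+
  have hE_lim: "(\<lambda>n. h n x\<^sub>0) \<longlonglongrightarrow> prob (hits_at M X B z)"
    unfolding hE[symmetric]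
  proof (rule tendsto_measure_of_eventually_iff)
    show "E n \<in> events" for n
      unfolding E_def by measurable
    show "hits_at M X B z \<subseteq> space M"
      by (auto simp: hits_at_def)
    show "eventually (\<lambda>n. \<omega> \<in> E n \<longleftrightarrow> \<omega> \<in> hits_at M X B z) sequentially" if "\<omega> \<in> space M" for \<omega>
      using eventually_grid_hit_iff[of X \<omega> M z B, OF right[OF that] that \<open>z \<in> B\<close>] that
      by (simp add: E_def Y_def)
  qed
  obtain g and s :: "nat \<Rightarrow> nat" where s: "strict_mono s"
    and g: "\<And>x. x \<in> S \<Longrightarrow> (\<lambda>n. h (s n) x) \<longlonglongrightarrow> g x"
    using convergent_subsequence_on_finite[of S h 0 1, OF \<open>finite S\<close> h01] by blast
  show ?thesis
  proof
    show "g x \<in> {0..1}" if "x \<in> S" for x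
      using g[OF that] h01[OF that] by (auto intro: LIMSEQ_le_const LIMSEQ_le_const2)
    show "g x = of_bool (x = z)" if "x \<in> B" for x
      using g[of x] hB[OF that] that \<open>B \<subseteq> S\<close> by (auto simp: LIMSEQ_const_iff)
    show "prob (hits_at M X B z) = g x\<^sub>0"
      using LIMSEQ_subseq_LIMSEQ[OF hE_lim s] g[OF \<open>x\<^sub>0 \<in> S\<close>] by (auto simp: o_def intro: LIMSEQ_unique)
    show "(\<Sum>y\<in>S. r x y * (g y - g x)) = 0" if "x \<in> S - B" for x
    proof -
      \<comment> \<open>For \<open>y = x\<close> the increments are 0. Otherwise
        \<open>p 0 x y = 0\<close>, so the quotient is the difference quotient at 0 and tends to the
        jump rate.\<close>
      have rate: "(\<lambda>n. p (d (s n)) x y / d (s n) * (h (s n) y - h (s n) x)) \<longlonglongrightarrow> r x y * (g y - g x)"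
        if "y \<in> S" for y
      proof (cases "y = x")
        case False
        have "((\<lambda>t. p t x y / t) \<longlongrightarrow> r x y) (at 0 within {0..})"
          using p_deriv[of x y] p_init[of x y] that \<open>x \<in> S - B\<close> False
          by (auto simp: has_field_derivative_iff)
        moreover have "filterlim (\<lambda>n. d (s n)) (at 0 within {0..}) sequentially"
          using LIMSEQ_subseq_LIMSEQ[OF d_lim s] d0
          by (auto simp: filterlim_at o_def less_imp_le intro!: always_eventually less_imp_neq[symmetric])
        ultimately have "(\<lambda>n. p (d (s n)) x y / d (s n)) \<longlonglongrightarrow> r x y"
          by (rule filterlim_compose)
        then show ?thesis
          using g[of x] g[of y] that \<open>x \<in> S - B\<close> by (intro tendsto_intros) auto
      qed simp
      \<comment> \<open>As the rows of \<open>p (d n)\<close> sum to 1, harmonicity says that the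
        weighted increments add up to 0, and this form can be divided by \<open>d n\<close>.\<close>
      have "(\<Sum>y\<in>S. p (d n) x y / d n * (h n y - h n x)) = 0" for n
      proof -
        have "(\<Sum>y\<in>S. p (d n) x y * (h n y - h n x)) = h n x - (\<Sum>y\<in>S. p (d n) x y) * h n x"
          using hharm[OF that, of n] by (simp add: right_diff_distrib sum_subtractf sum_distrib_right)
        also have "\<dots> = 0"
          using p1[of "d n" x] d0[of n] that by simp
        finally show ?thesis
          by (simp add: sum_divide_distrib[symmetric])
      qed
      moreover have "(\<lambda>n. \<Sum>y\<in>S. p (d (s n)) x y / d (s n) * (h (s n) y - h (s n) x))
          \<longlonglongrightarrow> (\<Sum>y\<in>S. r x y * (g y - g x))"
        using rate by (intro tendsto_sum) auto
      ultimately show ?thesis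
        by (simp add: LIMSEQ_const_iff)
    qed
  qed
qed

section \<open>Harmonic functions on electrical networks\<close>

text \<open>Sum the harmonic equations over \<open>C\<close>: inside \<open>C\<close> the
  conductances are symmetric and the increments antisymmetric, so these terms cancel in
  pairs.\<close>

lemma network_flux:
  fixes c :: "'a \<Rightarrow> 'a \<Rightarrow> real"
  assumes "finite C" and sym: "\<And>x y. x \<in> C \<Longrightarrow> y \<in> C \<Longrightarrow> c x y = c y x"
    and harm: "\<And>x. x \<in> C \<Longrightarrow> (\<Sum>y\<in>C. c x y * (h y - h x)) + (\<Sum>y\<in>B. c x y * (h y - h x)) = 0"
  shows "(\<Sum>x\<in>C. \<Sum>y\<in>B. c x y * (h y - h x)) = 0"
proof -
  have "(\<Sum>x\<in>C. \<Sum>y\<in>C. c x y * (h y - h x)) = (\<Sum>x\<in>C. \<Sum>y\<in>C. - (c x y * (h y - h x)))"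
    by (subst sum.swap) (auto intro!: sum.cong simp: sym algebra_simps)
  then have "(\<Sum>x\<in>C. \<Sum>y\<in>C. c x y * (h y - h x)) = 0"
    by (simp add: sum_negf)
  moreover have "(\<Sum>x\<in>C. (\<Sum>y\<in>C. c x y * (h y - h x)) + (\<Sum>y\<in>B. c x y * (h y - h x))) = 0"
    using harm by simp
  ultimately show ?thesis
    by (simp add: sum.distrib)
qed

text \<open>Multiply the harmonic equation at \<open>x\<close> by \<open>h x\<close> and sum over \<open>C\<close>.\<close>

lemma network_energy:
  fixes c :: "'a \<Rightarrow> 'a \<Rightarrow> real"
  assumes "finite C" and sym: "\<And>x y. x \<in> C \<Longrightarrow> y \<in> C \<Longrightarrow> c x y = c y x"
    and nonneg: "\<And>x y. x \<in> C \<Longrightarrow> y \<in> B \<Longrightarrow> 0 \<le> c x y"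
    and bounds: "\<And>x. x \<in> C \<union> B \<Longrightarrow> h x \<in> {0..1}"
    and harm: "\<And>x. x \<in> C \<Longrightarrow> (\<Sum>y\<in>C. c x y * (h y - h x)) + (\<Sum>y\<in>B. c x y * (h y - h x)) = 0"
  shows "(\<Sum>x\<in>C. \<Sum>y\<in>C. c x y * (h x - h y)\<^sup>2) \<le> 2 * (\<Sum>x\<in>C. \<Sum>y\<in>B. c x y)"
proof -
  let ?A = "\<Sum>x\<in>C. \<Sum>y\<in>C. c x y * (h x * (h x - h y))"
  \<comment> \<open>Exchanging the two summation variables and adding both forms of
    \<open>?A\<close> completes the square, so the energy is \<open>2 * ?A\<close>.\<close>
  have "?A = (\<Sum>x\<in>C. \<Sum>y\<in>C. c x y * (h y * (h y - h x)))"
    by (subst sum.swap) (auto intro!: sum.cong simp: sym)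
  then have "2 * ?A = ?A + (\<Sum>x\<in>C. \<Sum>y\<in>C. c x y * (h y * (h y - h x)))"
    by simp
  then have "(\<Sum>x\<in>C. \<Sum>y\<in>C. c x y * (h x - h y)\<^sup>2) = 2 * ?A"
    by (simp only: sum.distrib[symmetric]) (simp add: algebra_simps power2_eq_square)
  also have "?A = (\<Sum>x\<in>C. h x * (\<Sum>y\<in>B. c x y * (h y - h x)))"
  proof (rule sum.cong[OF refl])
    fix x assume "x \<in> C"
    have "(\<Sum>y\<in>C. c x y * (h x * (h x - h y))) = - (h x * (\<Sum>y\<in>C. c x y * (h y - h x)))"
      by (simp add: sum_distrib_left sum_negf[symmetric] algebra_simps)
    also have "\<dots> = h x * (\<Sum>y\<in>B. c x y * (h y - h x))"
      using harm[OF \<open>x \<in> C\<close>] by (simp add: add_eq_0_iff)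
    finally show "(\<Sum>y\<in>C. c x y * (h x * (h x - h y))) = h x * (\<Sum>y\<in>B. c x y * (h y - h x))" .
  qed
  also have "\<dots> = (\<Sum>x\<in>C. \<Sum>y\<in>B. c x y * (h x * (h y - h x)))"
    by (simp add: sum_distrib_left algebra_simps)
  also have "\<dots> \<le> (\<Sum>x\<in>C. \<Sum>y\<in>B. c x y)"
  proof (intro sum_mono)
    fix x y assume "x \<in> C" "y \<in> B"
    then have "0 \<le> h x" "h x \<le> 1" "h y \<le> 1"
      using bounds[of x] bounds[of y] by auto
    then have "h x * (h y - h x) \<le> 1"
      using mult_mono[of "h x" 1 "h y - h x" 1] by (cases "h y \<le> h x") (auto simp: mult_nonneg_nonpos intro: order_trans[of _ 0])
    then show "c x y * (h x * (h y - h x)) \<le> c x y"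
      using nonneg[OF \<open>x \<in> C\<close> \<open>y \<in> B\<close>] by (rule mult_left_le)
  qed
  finally show ?thesis
    by simp
qed

text \<open>The conductances are taken as already rescaled: those into \<open>B\<close> have finite
  limits \<open>a\<close>, while those along the edges in \<open>R\<close> diverge. The energy thus
  stays bounded and forces \<open>h\<close> to flatten along \<open>R\<close>; the flux identity
  then fixes the common value.\<close>

lemma network_limit:
  fixes c :: "'b \<Rightarrow> 'a \<Rightarrow> 'a \<Rightarrow> real" and F :: "'b filter"
  assumes "finite C"
    and sym: "\<And>b x y. x \<in> C \<Longrightarrow> y \<in> C \<Longrightarrow> c b x y = c b y x"
    and nonneg: "\<And>b x y. x \<in> C \<Longrightarrow> y \<in> C \<union> B \<Longrightarrow> 0 \<le> c b x y"
    and bounds: "\<forall>\<^sub>F b in F. \<forall>x\<in>C \<union> B. h b x \<in> {0..1}"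
    and boundary: "\<forall>\<^sub>F b in F. \<forall>y\<in>B. h b y = g y"
    and harm: "\<forall>\<^sub>F b in F. \<forall>x\<in>C.
      (\<Sum>y\<in>C. c b x y * (h b y - h b x)) + (\<Sum>y\<in>B. c b x y * (h b y - h b x)) = 0"
    and inner: "\<And>x y. (x, y) \<in> R \<Longrightarrow> x \<in> C \<and> y \<in> C \<and> filterlim (\<lambda>b. c b x y) at_top F"
    and conn: "\<And>x. x \<in> C \<Longrightarrow> (x\<^sub>0, x) \<in> R\<^sup>*"
    and outer: "\<And>x y. x \<in> C \<Longrightarrow> y \<in> B \<Longrightarrow> ((\<lambda>b. c b x y) \<longlongrightarrow> a x y) F"
    and pos: "(\<Sum>x\<in>C. \<Sum>y\<in>B. a x y) \<noteq> 0"
  shows "((\<lambda>b. h b x\<^sub>0) \<longlongrightarrow> (\<Sum>x\<in>C. \<Sum>y\<in>B. a x y * g y) / (\<Sum>x\<in>C. \<Sum>y\<in>B. a x y)) F"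
proof -
  have edge: "((\<lambda>b. h b y - h b x) \<longlongrightarrow> 0) F" if "(x, y) \<in> R" for x y
  proof -
    have xy: "x \<in> C" "y \<in> C" and top: "filterlim (\<lambda>b. c b x y) at_top F"
      using inner[OF that] by auto
    have "((\<lambda>b. 2 * (\<Sum>x\<in>C. \<Sum>y\<in>B. c b x y)) \<longlongrightarrow> 2 * (\<Sum>x\<in>C. \<Sum>y\<in>B. a x y)) F"
      using outer by (intro tendsto_intros) auto
    then have lim: "((\<lambda>b. 2 * (\<Sum>x\<in>C. \<Sum>y\<in>B. c b x y) / c b x y) \<longlongrightarrow> 0) F"
      by (rule tendsto_divide_0[OF _ filterlim_at_top_imp_at_infinity[OF top]])
    have "\<forall>\<^sub>F b in F. (h b y - h b x)\<^sup>2 \<le> 2 * (\<Sum>x\<in>C. \<Sum>y\<in>B. c b x y) / c b x y"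
      using bounds harm filterlim_at_top_dense[THEN iffD1, OF top, rule_format, of 0]
    proof eventually_elim
      case (elim b)
      \<comment> \<open>One edge contributes at most the whole energy, which is at most twice the
        total boundary conductance. Division by the diverging \<open>c b x y\<close> makes the
        squared increment vanish.\<close>
      have "c b x y * (h b x - h b y)\<^sup>2 \<le> (\<Sum>y\<in>C. c b x y * (h b x - h b y)\<^sup>2)"
        using xy nonneg \<open>finite C\<close> by (intro member_le_sum) auto
      also have "\<dots> \<le> (\<Sum>x\<in>C. \<Sum>y\<in>C. c b x y * (h b x - h b y)\<^sup>2)"
        using xy nonneg \<open>finite C\<close>
        by (intro member_le_sum[of x C "\<lambda>x. \<Sum>y\<in>C. c b x y * (h b x - h b y)\<^sup>2"] sum_nonneg) auto
      also have "\<dots> \<le> 2 * (\<Sum>x\<in>C. \<Sum>y\<in>B. c b x y)"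
        using elim sym nonneg \<open>finite C\<close> by (intro network_energy) auto
      finally show ?case
        using elim by (simp add: field_simps power2_commute)
    qed
    then have "((\<lambda>b. (h b y - h b x)\<^sup>2) \<longlongrightarrow> 0) F"
      by (intro tendsto_sandwich[OF _ _ tendsto_const lim]) auto
    then have "((\<lambda>b. sqrt ((h b y - h b x)\<^sup>2)) \<longlongrightarrow> sqrt 0) F"
      by (rule tendsto_real_sqrt)
    then show ?thesis
      by (simp add: tendsto_rabs_zero_iff)
  qed
  have close: "((\<lambda>b. h b x - h b x\<^sub>0) \<longlongrightarrow> 0) F" if "x \<in> C" for x
    using conn[OF that]
  proof (induction rule: rtrancl_induct)
    case base
    show ?case by simp
  next
    case (step x y)
    show ?case
      using tendsto_add[OF step.IH edge[OF step.hyps(2)]] by simp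
  qed
  let ?N = "\<lambda>b. \<Sum>x\<in>C. \<Sum>y\<in>B. c b x y"
  have N: "(?N \<longlongrightarrow> (\<Sum>x\<in>C. \<Sum>y\<in>B. a x y)) F"
    using outer by (intro tendsto_sum) auto
  \<comment> \<open>This quotient is the vanishing flux solved for \<open>h b x\<^sub>0\<close>. The
    second sum is the error of replacing each \<open>h b x\<close> by \<open>h b x\<^sub>0\<close>,
    and it tends to 0.\<close>
  have "((\<lambda>b. ((\<Sum>x\<in>C. \<Sum>y\<in>B. c b x y * g y) - (\<Sum>x\<in>C. \<Sum>y\<in>B. c b x y * (h b x - h b x\<^sub>0))) / ?N b)
      \<longlongrightarrow> ((\<Sum>x\<in>C. \<Sum>y\<in>B. a x y * g y) - (\<Sum>x\<in>C. \<Sum>y\<in>B. a x y * 0)) / (\<Sum>x\<in>C. \<Sum>y\<in>B. a x y)) F"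
    using outer close N pos by (intro tendsto_intros) auto
  moreover have "\<forall>\<^sub>F b in F. ((\<Sum>x\<in>C. \<Sum>y\<in>B. c b x y * g y)
      - (\<Sum>x\<in>C. \<Sum>y\<in>B. c b x y * (h b x - h b x\<^sub>0))) / ?N b = h b x\<^sub>0"
    using boundary harm tendsto_imp_eventually_ne[OF N pos]
  proof eventually_elim
    case (elim b)
    have "(\<Sum>x\<in>C. \<Sum>y\<in>B. c b x y * (g y - h b x)) = (\<Sum>x\<in>C. \<Sum>y\<in>B. c b x y * (h b y - h b x))"
      using elim by (intro sum.cong) auto
    also have "\<dots> = 0"
      using elim sym \<open>finite C\<close> by (intro network_flux) auto
    finally have "(\<Sum>x\<in>C. \<Sum>y\<in>B. c b x y * g y) - (\<Sum>x\<in>C. \<Sum>y\<in>B. c b x y * (h b x - h b x\<^sub>0))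
        = h b x\<^sub>0 * ?N b"
      by (simp add: algebra_simps sum.distrib sum_subtractf sum_distrib_left)
    then show ?case
      using elim by simp
  qed
  ultimately show ?thesis
    by (simp add: tendsto_cong)
qed

section \<open>The exit distribution of a cycle\<close>

text \<open>Connectedness of the induced subgraph is reachability in the symmetric closure of its
  arcs. As the arcs of \<open>G\<close> are symmetric, each step of the closure is an edge of
  \<open>G\<close> inside \<open>C\<close>.\<close>

lemma (in graph) rtrancl_of_connected_subgraph:
  assumes "Digraph_Component.connected (G \<restriction> C)" and "C \<subseteq> verts G" and "x \<in> C" and "y \<in> C"
  shows "(x, y) \<in> {(x, y). x \<in> C \<and> y \<in> C \<and> dominates G x y}\<^sup>*"
proof -
  interpret S: wf_digraph "G \<restriction> C"
    by (rule wellformed_induce_subgraph)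
  have "(x, y) \<in> rtrancl_on C ((arcs_ends (G \<restriction> C))\<^sup>s)"
    using assms by (simp add: connected_conv)
  then have "(x, y) \<in> ((arcs_ends (G \<restriction> C))\<^sup>s)\<^sup>*"
    by (rule rtrancl_on_rtranclI)
  moreover have "(arcs_ends (G \<restriction> C))\<^sup>s \<subseteq> {(x, y). x \<in> C \<and> y \<in> C \<and> dominates G x y}"
  proof -
    have "u \<in> C \<and> v \<in> C \<and> dominates G u v" if "dominates (G \<restriction> C) u v" for u v
      using S.adj_in_verts[OF that] dominates_induce_subgraphD[OF that] by simp
    then show ?thesis
      using arcs_ends_symmetric[OF sym_arcs] by (auto simp: symcl_def)
  qed
  ultimately show ?thesis
    using rtrancl_mono by blast
qed

theorem theorem2p17:
  fixes G :: "('a, 'b) pre_digraph" and H :: "'a \<Rightarrow> real" and C :: "'a set"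
    and M :: "real \<Rightarrow> 'w measure" and \<eta> :: "real \<Rightarrow> real \<Rightarrow> 'w \<Rightarrow> 'a"
    and \<xi>\<^sub>0 \<eta>\<^sub>0 :: 'a
  assumes "graph G" and "Digraph_Component.connected G"
    and "energy_cycle G H C" and "C \<noteq> verts G"
    and "\<xi>\<^sub>0 \<in> min_boundary G H C" and "\<eta>\<^sub>0 \<in> C"
    and "\<And>\<beta>. \<beta> > 0 \<Longrightarrow> markov_chain (verts G) (metropolis_rate G H \<beta>) \<eta>\<^sub>0 (M \<beta>) (\<eta> \<beta>)"
  shows "((\<lambda>\<beta>. measure (M \<beta>) (hits_at (M \<beta>) (\<eta> \<beta>) (outer_boundary G C) \<xi>\<^sub>0))
          \<longlongrightarrow> (\<Sum>\<zeta>\<in>C. of_bool (dominates G \<zeta> \<xi>\<^sub>0)) /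
              (\<Sum>\<zeta>\<in>C. \<Sum>\<xi>\<in>min_boundary G H C. of_bool (dominates G \<zeta> \<xi>))) at_top"
proof -
  interpret graph G by fact

  \<comment> \<open>Energy levels of the cycle and its boundary\<close>
  define B where "B = outer_boundary G C"
  define m where "m = Min (H ` B)"
  have "C \<subseteq> verts G" and conn: "Digraph_Component.connected (G \<restriction> C)"
    using assms(3) by (auto simp: energy_cycle_def)
  have "B \<subseteq> verts G - C"
    by (auto simp: B_def outer_boundary_def)
  have fin: "finite C" "finite B"
    using \<open>C \<subseteq> verts G\<close> \<open>B \<subseteq> verts G - C\<close> finite_verts by (auto intro: finite_subset)
  have sym: "dominates G x y \<longleftrightarrow> dominates G y x" for x y
    using arcs_ends_symmetric[OF sym_arcs] by blast
  have min_boundary: "min_boundary G H C = {\<xi>\<in>B. H \<xi> = m}"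
    by (simp add: min_boundary_def B_def m_def)
  then have "\<xi>\<^sub>0 \<in> B" "H \<xi>\<^sub>0 = m"
    using assms(5) by auto
  have m_le: "m \<le> H y" if "y \<in> B" for y
    using that fin by (simp add: m_def)
  have less_m: "H x < m" if "x \<in> C" for x
  proof -
    \<comment> \<open>The boundary contains \<open>\<xi>\<^sub>0\<close>, which rules out the empty
      case in \<open>energy_cycle\<close>.\<close>
    have "Max (H ` C) < m"
      using assms(3) \<open>\<xi>\<^sub>0 \<in> B\<close> by (auto simp: energy_cycle_def m_def B_def)
    moreover have "H x \<le> Max (H ` C)"
      using that fin by simp
    ultimately show ?thesis
      by simp
  qed
  obtain x\<^sub>1 where "x\<^sub>1 \<in> C" "dominates G x\<^sub>1 \<xi>\<^sub>0"
    using \<open>\<xi>\<^sub>0 \<in> B\<close> sym by (auto simp: B_def outer_boundary_def)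

  \<comment> \<open>Exit probabilities as harmonic functions\<close>
  define Q where "Q \<beta> h \<longleftrightarrow> (\<forall>x\<in>verts G. h x \<in> {0..1}) \<and> (\<forall>y\<in>B. h y = of_bool (y = \<xi>\<^sub>0)) \<and>
      (\<forall>x\<in>verts G - B. (\<Sum>y\<in>verts G. metropolis_rate G H \<beta> x y * (h y - h x)) = 0) \<and>
      measure (M \<beta>) (hits_at (M \<beta>) (\<eta> \<beta>) B \<xi>\<^sub>0) = h \<eta>\<^sub>0" for \<beta> h
  have "\<exists>h. Q \<beta> h" if pos: "\<beta> > 0" for \<beta>
  proof -
    have "B \<subseteq> verts G" "\<eta>\<^sub>0 \<in> verts G"
      using \<open>B \<subseteq> verts G - C\<close> \<open>C \<subseteq> verts G\<close> \<open>\<eta>\<^sub>0 \<in> C\<close> by auto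
    then obtain h where "\<And>x. x \<in> verts G \<Longrightarrow> h x \<in> {0..1}" "\<And>x. x \<in> B \<Longrightarrow> h x = of_bool (x = \<xi>\<^sub>0)"
      "\<And>x. x \<in> verts G - B \<Longrightarrow> (\<Sum>y\<in>verts G. metropolis_rate G H \<beta> x y * (h y - h x)) = 0"
      "measure (M \<beta>) (hits_at (M \<beta>) (\<eta> \<beta>) B \<xi>\<^sub>0) = h \<eta>\<^sub>0"
      using markov_chain_hitting_harmonic[OF assms(7)[OF pos] finite_verts _ \<open>\<xi>\<^sub>0 \<in> B\<close>] by blast
    then show ?thesis
      unfolding Q_def by (intro exI[of _ h] conjI ballI)
  qed
  then obtain h where "\<And>\<beta>. \<beta> > 0 \<Longrightarrow> Q \<beta> (h \<beta>)"
    by metis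
  then have h01: "\<And>\<beta> x. \<beta> > 0 \<Longrightarrow> x \<in> verts G \<Longrightarrow> h \<beta> x \<in> {0..1}"
    and hB: "\<And>\<beta> y. \<beta> > 0 \<Longrightarrow> y \<in> B \<Longrightarrow> h \<beta> y = of_bool (y = \<xi>\<^sub>0)"
    and hharm: "\<And>\<beta> x. \<beta> > 0 \<Longrightarrow> x \<in> verts G - B \<Longrightarrow>
      (\<Sum>y\<in>verts G. metropolis_rate G H \<beta> x y * (h \<beta> y - h \<beta> x)) = 0"
    and hits: "\<And>\<beta>. \<beta> > 0 \<Longrightarrow> measure (M \<beta>) (hits_at (M \<beta>) (\<eta> \<beta>) B \<xi>\<^sub>0) = h \<beta> \<eta>\<^sub>0"
    unfolding Q_def by blast+

  \<comment> \<open>The Metropolis rates are reversible for the Gibbs weights; \<open>c\<close> are the conductances,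
    rescaled by \<open>exp (\<beta> * m)\<close>.\<close>
  define c where "c \<beta> x y = of_bool (dominates G x y) * exp (- \<beta> * (max (H x) (H y) - m))"
    for \<beta> x y
  \<comment> \<open>Here \<open>max (H x) (H y) = H x + max (H y - H x) 0\<close>.\<close>
  have c_rate: "c \<beta> x y = exp (- \<beta> * (H x - m)) * metropolis_rate G H \<beta> x y" for \<beta> x y
    by (auto simp: c_def metropolis_rate_def max_def mult_exp_exp algebra_simps)
  \<comment> \<open>The limiting conductances from \<open>C\<close> into the boundary: weight 1 on
    edges into its minimal points, 0 elsewhere.\<close>
  define a :: "'a \<Rightarrow> 'a \<Rightarrow> real" where "a x y = of_bool (dominates G x y \<and> H y = m)" for x y
  let ?R = "{(x, y). x \<in> C \<and> y \<in> C \<and> dominates G x y}"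
  have "((\<lambda>\<beta>. h \<beta> \<eta>\<^sub>0) \<longlongrightarrow>
      (\<Sum>x\<in>C. \<Sum>y\<in>B. a x y * of_bool (y = \<xi>\<^sub>0)) / (\<Sum>x\<in>C. \<Sum>y\<in>B. a x y)) at_top"
  proof (rule network_limit[OF fin(1), where c=c and R="?R"])
    show "c \<beta> x y = c \<beta> y x" for \<beta> x y
      using sym by (simp add: c_def max.commute)
    show "0 \<le> c \<beta> x y" for \<beta> x y
      by (simp add: c_def)
    show "\<forall>\<^sub>F \<beta> in at_top. \<forall>x\<in>C \<union> B. h \<beta> x \<in> {0..1}"
      using h01 \<open>C \<subseteq> verts G\<close> \<open>B \<subseteq> verts G - C\<close>
      by (intro eventually_mono[OF eventually_gt_at_top[of 0]]) blast
    show "\<forall>\<^sub>F \<beta> in at_top. \<forall>y\<in>B. h \<beta> y = of_bool (y = \<xi>\<^sub>0)"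
      using hB by (intro eventually_mono[OF eventually_gt_at_top[of 0]]) blast
    show "\<forall>\<^sub>F \<beta> in at_top. \<forall>x\<in>C.
        (\<Sum>y\<in>C. c \<beta> x y * (h \<beta> y - h \<beta> x)) + (\<Sum>y\<in>B. c \<beta> x y * (h \<beta> y - h \<beta> x)) = 0"
      using eventually_gt_at_top[of 0]
    proof eventually_elim
      case (elim \<beta>)
      show ?case
      proof
        fix x assume "x \<in> C"
        let ?f = "\<lambda>y. c \<beta> x y * (h \<beta> y - h \<beta> x)"
        \<comment> \<open>A neighbour of a point of \<open>C\<close> lies in \<open>C\<close> or in
          \<open>B\<close>, so the sum over all vertices reduces to these two sets.\<close>
        have "c \<beta> x y = 0" if "y \<in> verts G - (C \<union> B)" for y
          using that \<open>x \<in> C\<close> sym by (auto simp: c_def B_def outer_boundary_def)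
        then have "sum ?f (C \<union> B) = sum ?f (verts G)"
          using \<open>C \<subseteq> verts G\<close> \<open>B \<subseteq> verts G - C\<close> by (intro sum.mono_neutral_left) auto
        also have "\<dots> = exp (- \<beta> * (H x - m)) *
            (\<Sum>y\<in>verts G. metropolis_rate G H \<beta> x y * (h \<beta> y - h \<beta> x))"
          by (simp add: c_rate sum_distrib_left mult.assoc)
        also have "\<dots> = 0"
          using hharm[OF elim, of x] \<open>x \<in> C\<close> \<open>C \<subseteq> verts G\<close> \<open>B \<subseteq> verts G - C\<close> by auto
        finally show "sum ?f C + sum ?f B = 0"
          using \<open>B \<subseteq> verts G - C\<close> fin by (subst (asm) sum.union_disjoint) auto
      qed
    qed
    show "x \<in> C \<and> y \<in> C \<and> filterlim (\<lambda>\<beta>. c \<beta> x y) at_top at_top" if "(x, y) \<in> ?R" for x y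
    proof -
      have "0 < m - max (H x) (H y)"
        using that less_m by auto
      then have "filterlim (\<lambda>\<beta>. exp ((m - max (H x) (H y)) * \<beta>)) at_top at_top"
        by (intro filterlim_compose[OF exp_at_top]
            filterlim_tendsto_pos_mult_at_top[OF tendsto_const _ filterlim_ident])
      then show ?thesis
        using that by (simp add: c_def algebra_simps)
    qed
    show "(\<eta>\<^sub>0, x) \<in> ?R\<^sup>*" if "x \<in> C" for x
      using rtrancl_of_connected_subgraph[OF conn \<open>C \<subseteq> verts G\<close> \<open>\<eta>\<^sub>0 \<in> C\<close> that] .
    \<comment> \<open>The larger energy on such an edge is \<open>H y\<close>. The rescaled
      conductance is constant in \<beta> if \<open>H y = m\<close> and decays exponentially if
      \<open>H y > m\<close>.\<close>
    show "((\<lambda>\<beta>. c \<beta> x y) \<longlongrightarrow> a x y) at_top" if "x \<in> C" "y \<in> B" for x y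
    proof (cases "H y = m")
      case True
      then show ?thesis
        using less_m[OF \<open>x \<in> C\<close>] by (simp add: c_def a_def max_def)
    next
      case False
      then have "0 < H y - m" "max (H x) (H y) = H y"
        using m_le[OF \<open>y \<in> B\<close>] less_m[OF \<open>x \<in> C\<close>] by auto
      then have "filterlim (\<lambda>\<beta>. (H y - m) * \<beta>) at_top at_top"
        by (intro filterlim_tendsto_pos_mult_at_top[OF tendsto_const _ filterlim_ident])
      then have "((\<lambda>\<beta>. exp (- ((H y - m) * \<beta>))) \<longlongrightarrow> 0) at_top"
        by (intro filterlim_compose[OF exp_at_bot])
          (simp add: filterlim_uminus_at_bot)
      then have "((\<lambda>\<beta>. of_bool (dominates G x y) * exp (- ((H y - m) * \<beta>))) \<longlongrightarrow> 0) at_top"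
        by (rule tendsto_mult_right_zero)
      then show ?thesis
        using False \<open>max (H x) (H y) = H y\<close> by (simp add: c_def a_def mult.commute)
    qed
    \<comment> \<open>The edge from \<open>x\<^sub>1\<close> to \<open>\<xi>\<^sub>0\<close> alone
      keeps the denominator positive.\<close>
    have "0 < (\<Sum>y\<in>B. a x\<^sub>1 y)"
      using \<open>\<xi>\<^sub>0 \<in> B\<close> \<open>H \<xi>\<^sub>0 = m\<close> \<open>dominates G x\<^sub>1 \<xi>\<^sub>0\<close> fin
      by (intro sum_pos2[of _ \<xi>\<^sub>0]) (auto simp: a_def)
    then have "0 < (\<Sum>x\<in>C. \<Sum>y\<in>B. a x y)"
      by (rule sum_pos2[OF fin(1) \<open>x\<^sub>1 \<in> C\<close>]) (simp add: a_def sum_nonneg)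
    then show "(\<Sum>x\<in>C. \<Sum>y\<in>B. a x y) \<noteq> 0"
      by simp
  qed
  moreover have "(\<Sum>y\<in>B. a x y * of_bool (y = \<xi>\<^sub>0)) = of_bool (dominates G x \<xi>\<^sub>0)" for x
    using \<open>\<xi>\<^sub>0 \<in> B\<close> \<open>H \<xi>\<^sub>0 = m\<close> fin by (simp add: a_def)
  moreover have "(\<Sum>y\<in>B. a x y) = (\<Sum>\<xi>\<in>min_boundary G H C. of_bool (dominates G x \<xi>))" for x
    unfolding min_boundary using fin by (intro sum.mono_neutral_cong_right) (auto simp: a_def)
  moreover have "\<forall>\<^sub>F \<beta> in at_top. h \<beta> \<eta>\<^sub>0 = measure (M \<beta>) (hits_at (M \<beta>) (\<eta> \<beta>) B \<xi>\<^sub>0)"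
    using hits by (intro eventually_mono[OF eventually_gt_at_top[of 0]]) simp
  ultimately show ?thesis
    by (simp add: B_def tendsto_cong)
qed

end
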